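(* Let $r\ge 2$ and let $l_1,l_2,\dots,l_r$ and $t$ be positive integers such that $l=\min(l_1,l_2,\dots,l_r)\geq t+2$. Then there exists a constant $n_0=n_0(l_1,l_2,\dots,l_r,t)$ depending only on $l_1,\dots,l_r$ and $t$ such that the following holds for all $n_1,\dots,n_r\geq n_0$: if families $\mathcal A_j\subseteq P(n_j,l_j)$ ($j=1,2,\dots,r$) are $r$-cross $t$-intersecting, then \[ \prod_{j=1}^r |\mathcal A_j|\leq \prod_{j=1}^r \binom{n_j+l_j-t-1}{l_j-t-1}. \] Moreover, equality holds if and only if there is a $t$-element subset $T$ of $\{1,2,\dots,l\}$ such that $\mathcal A_j=\{\mathbf u\in P(n_j,l_j) : \mathbf u(i)=0 \text{ for all } i\in T\}$ for every $j=1,2,\dots,r$.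
   Context: $\mathbb N_0$ denotes the set of non-negative integers. For positive integers $n,l$, $P(n,l)=\{(x_1,\dots,x_l)\in\mathbb N_0^l : x_1+\cdots+x_l=n\}$ is the set of weak compositions of $n$ with $l$ parts; for $\mathbf u=(u_1,\dots,u_l)\in P(n,l)$, $\mathbf u(i)=u_i$ denotes its $i$-th coordinate. Given $\mathbf u_j\in P(n_j,l_j)$ for $j=1,\dots,r$ and $l=\min(l_1,\dots,l_r)$, let $I(\mathbf u_1,\dots,\mathbf u_r)=\{i\in\{1,\dots,l\} : \mathbf u_1(i)=\mathbf u_2(i)=\cdots=\mathbf u_r(i)\}$. Families $\mathcal A_j\subseteq P(n_j,l_j)$ ($j=1,\dots,r$) are $r$-cross $t$-intersecting if $|I(\mathbf u_1,\dots,\mathbf u_r)|\ge t$ for all choices $\mathbf u_j\in\mathcal A_j$, $j=1,\dots,r$. *)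

theory Defs
  imports Complex_Main "HOL-Library.FuncSet"
begin

text \<open>
  A tuple \<open>(x\<^sub>1, \<dots>, x\<^sub>l)\<close> of natural numbers is an extensional function on \<open>{1..l}\<close>, so that two
  compositions are equal iff they agree in every coordinate.
\<close>

definition weak_compositions :: "nat \<Rightarrow> nat \<Rightarrow> (nat \<Rightarrow> nat) set" where
  "weak_compositions n l = {x \<in> {1..l} \<rightarrow>\<^sub>E UNIV. (\<Sum>i = 1..l. x i) = n}"

definition min_parts :: "nat \<Rightarrow> (nat \<Rightarrow> nat) \<Rightarrow> nat" where
  "min_parts r l = Min (l ` {1..r})"

text \<open>
  A sequence indexed by \<open>1, \<dots>, r\<close> (of lengths, of compositions, of families) is a function on
  \<^typ>\<open>nat\<close> of which only the values on \<open>{1..r}\<close> are used.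
\<close>

definition agreement :: "nat \<Rightarrow> (nat \<Rightarrow> nat) \<Rightarrow> (nat \<Rightarrow> nat \<Rightarrow> nat) \<Rightarrow> nat set" where
  "agreement r l u = {i \<in> {1..min_parts r l}. \<forall>j\<in>{1..r}. \<forall>k\<in>{1..r}. u j i = u k i}"

definition cross_intersecting ::
    "nat \<Rightarrow> nat \<Rightarrow> (nat \<Rightarrow> nat) \<Rightarrow> (nat \<Rightarrow> (nat \<Rightarrow> nat) set) \<Rightarrow> bool" where
  "cross_intersecting r t l \<A> \<longleftrightarrow>
     (\<forall>u. (\<forall>j\<in>{1..r}. u j \<in> \<A> j) \<longrightarrow> t \<le> card (agreement r l u))"

end

theory Submission
  imports Defs
begin

text \<open>
  Fixing a member of another family shows that each family is covered by a bounded number of stars,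
  a star consisting of the compositions with prescribed values on a set \<open>T\<close> of \<open>t\<close> coordinates. A
  star of compositions of \<open>n\<close> has order \<open>n\<^sup>l\<^sup>-\<^sup>t\<^sup>-\<^sup>1\<close>, and prescribing one more coordinate costs a
  factor of order \<open>n\<close>. Hence a family of larger order than \<open>n\<^sup>l\<^sup>-\<^sup>t\<^sup>-\<^sup>2\<close> meets some star in more members
  than can agree with a given composition somewhere outside \<open>T\<close>, so all other families lie in the
  star with the same \<open>T\<close> and the same values. If two families are that large, applying this to the
  second one, with the same \<open>T\<close>, puts the first one into that star as well, and the values \<open>0\<close> are
  optimal. Otherwise some family is smaller than a star by a factor of order \<open>n\<close>, while all others
  exceed the size of a star by at most a constant factor.
\<close>

section \<open>Compositions over an arbitrary index set, and stars\<close>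

text \<open>Deleting a set \<open>T\<close> of coordinates from \<open>{1..l}\<close> leaves an
  index set that need not be an interval, hence the general \<open>I\<close>.\<close>

definition compositions_on :: "'a set \<Rightarrow> nat \<Rightarrow> ('a \<Rightarrow> nat) set" where
  "compositions_on I n = {x \<in> I \<rightarrow>\<^sub>E UNIV. sum x I = n}"

definition star :: "'a set \<Rightarrow> nat \<Rightarrow> 'a set \<Rightarrow> ('a \<Rightarrow> nat) \<Rightarrow> ('a \<Rightarrow> nat) set" where
  "star I n T c = {x \<in> compositions_on I n. \<forall>i\<in>T. x i = c i}"

lemma weak_compositions_eq: "weak_compositions n l = compositions_on {1..l} n"
  by (simp add: weak_compositions_def compositions_on_def)

lemma finite_compositions_on:
  assumes "finite I"
  shows "finite (compositions_on I n)"
proof (rule finite_subset)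
  show "compositions_on I n \<subseteq> I \<rightarrow>\<^sub>E {..n}"
  proof
    fix x assume x: "x \<in> compositions_on I n"
    then have "x i \<le> n" if "i \<in> I" for i
      using member_le_sum[of i I x] that assms by (simp add: compositions_on_def)
    then show "x \<in> I \<rightarrow>\<^sub>E {..n}" using x by (simp add: compositions_on_def PiE_iff)
  qed
qed (simp add: assms finite_PiE)

lemma finite_star: "finite I \<Longrightarrow> finite (star I n T c)"
  by (simp add: star_def finite_compositions_on)

section \<open>Counting compositions and stars\<close>

text \<open>Deleting the prescribed coordinates loses nothing, since \<open>c\<close> restores them;
  what remains is an arbitrary composition of the remaining total.\<close>

lemma bij_betw_star_compositions_on:
  assumes "finite I" "T \<subseteq> I" "sum c T \<le> n"
  shows "bij_betw (\<lambda>x. restrict x (I - T)) (star I n T c) (compositions_on (I - T) (n - sum c T))"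
proof (rule bij_betwI[where g = "\<lambda>y i. if i \<in> T then c i else y i"])
  have split: "sum x I = sum x T + sum x (I - T)" for x :: "'a \<Rightarrow> nat"
    using assms(1,2) by (metis add.commute sum.subset_diff)
  show "(\<lambda>x. restrict x (I - T)) \<in> star I n T c \<rightarrow> compositions_on (I - T) (n - sum c T)"
  proof
    fix x assume x: "x \<in> star I n T c"
    then have "sum x T = sum c T" by (intro sum.cong) (auto simp: star_def)
    then show "restrict x (I - T) \<in> compositions_on (I - T) (n - sum c T)"
      using x split[of x] by (auto simp: star_def compositions_on_def)
  qed
  show "(\<lambda>y i. if i \<in> T then c i else y i) \<in> compositions_on (I - T) (n - sum c T) \<rightarrow> star I n T c"
  proof
    fix y assume y: "y \<in> compositions_on (I - T) (n - sum c T)"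
    let ?x = "\<lambda>i. if i \<in> T then c i else y i"
    have "sum ?x T = sum c T" "sum ?x (I - T) = sum y (I - T)"
      by (auto intro: sum.cong)
    then show "?x \<in> star I n T c"
      using y split[of ?x] assms by (auto simp: star_def compositions_on_def PiE_iff extensional_def)
  qed
qed (use assms in \<open>auto simp: star_def compositions_on_def PiE_iff extensional_def fun_eq_iff\<close>)

lemma card_star:
  assumes "finite I" "T \<subseteq> I" "sum c T \<le> n"
  shows "card (star I n T c) = card (compositions_on (I - T) (n - sum c T))"
  using bij_betw_same_card[OF bij_betw_star_compositions_on[OF assms]] .

lemma star_empty:
  assumes "finite I" "T \<subseteq> I" "n < sum c T"
  shows "star I n T c = {}"
proof (rule ccontr)
  assume "star I n T c \<noteq> {}"
  then obtain x where x: "x \<in> star I n T c" by blast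
  then have "sum c T = sum x T" by (intro sum.cong) (auto simp: star_def)
  also have "\<dots> \<le> sum x I" using assms by (intro sum_mono2) auto
  also have "\<dots> = n" using x by (simp add: star_def compositions_on_def)
  finally show False using assms(3) by simp
qed

text \<open>In this form, with \<open>n\<close> below, the formula also covers the empty index set.\<close>

lemma card_compositions_on_aux:
  assumes "finite I"
  shows "card (compositions_on I n) = (n + card I - 1) choose n"
  using assms
proof (induction I arbitrary: n rule: finite_induct)
  case empty
  have "compositions_on {} n = (if n = 0 then {\<lambda>_. undefined} else {} :: ('a \<Rightarrow> nat) set)"
    by (auto simp: compositions_on_def)
  then show ?case by (cases n) auto
next
  case (insert a I)
  \<comment> \<open>Compositions are sorted by their value \<open>v\<close> at the new coordinate
    \<open>a\<close>; each class is a star with one prescribed coordinate.\<close>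
  have fibre: "card (star (insert a I) n {a} (\<lambda>_. v)) = (n - v + card I - 1) choose (n - v)"
    if "v \<le> n" for v
    using card_star[of "insert a I" "{a}" "\<lambda>_. v" n] that insert by simp
  have "compositions_on (insert a I) n = (\<Union>v\<in>{..n}. star (insert a I) n {a} (\<lambda>_. v))"
    using insert by (auto simp: star_def compositions_on_def)
  then have "card (compositions_on (insert a I) n)
      = (\<Sum>v\<le>n. card (star (insert a I) n {a} (\<lambda>_. v)))"
    by (simp only:) (rule card_UN_disjoint,
        auto simp: star_def finite_compositions_on insert.hyps)
  also have "\<dots> = (\<Sum>v\<le>n. (n - v + card I - 1) choose (n - v))"
    by (intro sum.cong) (auto simp: fibre)
  also have "\<dots> = (\<Sum>v\<le>n. (v + card I - 1) choose v)"
    by (rule sum.reindex_bij_witness[of _ "\<lambda>v. n - v" "\<lambda>v. n - v"]) auto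
  also have "\<dots> = (n + card I) choose n"
  proof (cases "card I")
    \<comment> \<open>By truncated subtraction \<open>(v - 1) choose v\<close> is 1 at
      \<open>v = 0\<close> and vanishes elsewhere. For nonempty \<open>I\<close> the sum is a
      hockey-stick identity.\<close>
    case 0
    have "(\<Sum>v\<le>n. (v - 1) choose v) = (\<Sum>v\<in>{0}. (v - 1) choose v)"
      by (rule sum.mono_neutral_right) auto
    then show ?thesis using 0 by simp
  next
    case (Suc m)
    then show ?thesis using sum_choose_lower[of m n] by (simp add: add.commute)
  qed
  finally show ?case using insert by simp
qed

lemma card_compositions_on:
  assumes "finite I" "I \<noteq> {}"
  shows "card (compositions_on I n) = (n + card I - 1) choose (card I - 1)"
proof -
  have "card I \<ge> 1" using assms by (simp add: Suc_leI card_gt_0_iff)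
  then show ?thesis
    using card_compositions_on_aux[OF assms(1)] binomial_symmetric[of n "n + card I - 1"] by simp
qed

lemma binomial_right_strict_mono:
  assumes "a < b" "0 < k" "k \<le> b"
  shows "a choose k < b choose k"
  using assms
proof (induction b)
  case (Suc b)
  have pos: "0 < b choose (k - 1)" using Suc.prems by simp
  have "Suc b choose k = (b choose (k - 1)) + (b choose k)"
    using Suc.prems(2) by (cases k) auto
  moreover have "a choose k \<le> b choose k"
    using Suc.prems(1) by (simp add: binomial_right_mono)
  ultimately show ?case using pos by linarith
qed simp

text \<open>The number of compositions does not decrease with the total, which is
  \<open>n - sum c T\<close> once the prescribed coordinates are removed.\<close>

lemma card_star_le:
  assumes "finite I" "T \<subset> I"
  shows "card (star I n T c) \<le> (n + card I - card T - 1) choose (card I - card T - 1)"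
proof (cases "sum c T \<le> n")
  case True
  have "card T < card I" "card (I - T) = card I - card T"
    using assms by (auto simp: psubset_card_mono card_Diff_subset finite_subset psubset_imp_subset)
  moreover have "I - T \<noteq> {}" using assms by blast
  ultimately show ?thesis
    using assms True
    by (simp add: card_star card_compositions_on binomial_right_mono psubset_imp_subset)
next
  case False
  then show ?thesis using assms by (simp add: star_empty psubset_imp_subset)
qed

lemma card_star_zero:
  assumes "finite I" "T \<subset> I" "\<forall>i\<in>T. c i = 0"
  shows "card (star I n T c) = (n + card I - card T - 1) choose (card I - card T - 1)"
proof -
  have "card T < card I" "card (I - T) = card I - card T"
    using assms by (auto simp: psubset_card_mono card_Diff_subset finite_subset psubset_imp_subset)
  moreover have "I - T \<noteq> {}" "sum c T = 0" using assms by auto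
  ultimately show ?thesis
    using assms by (simp add: card_star card_compositions_on psubset_imp_subset)
qed

text \<open>A nonzero prescribed value lowers the total left to distribute. Two free coordinates
  keep the lower binomial index positive, so the count drops strictly; with a single one it could
  stay at 1.\<close>

lemma card_star_less:
  assumes "finite I" "T \<subseteq> I" "card T + 2 \<le> card I" "i \<in> T" "c i \<noteq> 0"
  shows "card (star I n T c) < (n + card I - card T - 1) choose (card I - card T - 1)"
proof (cases "sum c T \<le> n")
  case True
  have "finite T" using assms finite_subset by blast
  then have "sum c T > 0" using assms by (metis gr0I sum_eq_0_iff)
  moreover have "card (I - T) = card I - card T"
    using assms by (simp add: card_Diff_subset finite_subset)
  moreover from this have "I - T \<noteq> {}" using assms by fastforce
  ultimately show ?thesis
    using assms True by (simp add: card_star card_compositions_on) (rule binomial_right_strict_mono, auto)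
next
  case False
  then show ?thesis using assms by (simp add: star_empty)
qed

section \<open>Large families and stars\<close>

text \<open>Pigeonhole: each member of \<open>X\<close> agrees with \<open>y\<close> on some
  \<open>t\<close>-subset of \<open>J\<close>, so \<open>card J choose t\<close> stars with values
  from \<open>y\<close> cover \<open>X\<close>.\<close>

lemma exists_large_star:
  assumes "finite J" "X \<subseteq> compositions_on I n"
    and agree: "\<And>x. x \<in> X \<Longrightarrow> t \<le> card {i \<in> J. x i = y i}"
    and large: "(card J choose t) * b < card X"
  obtains T where "T \<subseteq> J" "card T = t" "b < card (X \<inter> star I n T y)"
proof (rule ccontr)
  assume none: "\<not> thesis"
  let ?\<T> = "{T. T \<subseteq> J \<and> card T = t}"
  have fin: "finite ?\<T>" using assms(1) by simp
  have "X \<subseteq> (\<Union>T\<in>?\<T>. X \<inter> star I n T y)"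
  proof
    fix x assume x: "x \<in> X"
    obtain T where "T \<subseteq> {i \<in> J. x i = y i}" "card T = t"
      using agree[OF x] by (meson obtain_subset_with_card_n)
    then show "x \<in> (\<Union>T\<in>?\<T>. X \<inter> star I n T y)"
      using x assms(2) by (auto simp: star_def)
  qed
  then have "(\<Union>T\<in>?\<T>. X \<inter> star I n T y) = X" by blast
  then have "card X \<le> (\<Sum>T\<in>?\<T>. card (X \<inter> star I n T y))"
    using card_UN_le[OF fin, of "\<lambda>T. X \<inter> star I n T y"] by simp
  also have "\<dots> \<le> of_nat (card ?\<T>) * b"
    by (rule sum_bounded_above) (use none that in \<open>force simp: not_less\<close>)
  also have "\<dots> = (card J choose t) * b" using assms(1) by (simp add: n_subsets)
  finally show False using large by simp
qed

text \<open>If \<open>y\<close> departs from \<open>c\<close> somewhere on \<open>T\<close>, each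
  member of \<open>X\<close> must make up for it by agreeing with \<open>y\<close> at a place
  outside \<open>T\<close>. Then at most \<open>card I\<close> stars with one more prescribed
  coordinate cover \<open>X\<close>, which is too few members.\<close>

lemma large_star_forces:
  assumes "finite I" "J \<subseteq> I" "T \<subseteq> J" "card T + 2 \<le> card I" "X \<subseteq> star I n T c"
    and agree: "\<And>x. x \<in> X \<Longrightarrow> card T \<le> card {i \<in> J. x i = y i}"
    and large: "card I * ((n + card I - card T - 2) choose (card I - card T - 2)) < card X"
  shows "\<forall>i\<in>T. y i = c i"
proof (rule ccontr)
  assume "\<not> ?thesis"
  then obtain k where k: "k \<in> T" "y k \<noteq> c k" by blast
  have fin: "finite J" "finite T" using assms(1-3) by (meson finite_subset)+
  let ?m = "(n + card I - card T - 2) choose (card I - card T - 2)"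
  let ?S = "\<lambda>i. star I n (insert i T) (c(i := y i))"
  have "X \<subseteq> (\<Union>i\<in>J - T. ?S i)"
  proof
    fix x assume x: "x \<in> X"
    then have xT: "x i = c i" if "i \<in> T" for i using assms(5) that by (auto simp: star_def)
    have "\<exists>i\<in>J - T. x i = y i"
    proof (rule ccontr)
      assume "\<not> (\<exists>i\<in>J - T. x i = y i)"
      then have "{i \<in> J. x i = y i} \<subseteq> T - {k}" using xT k by auto
      then have "card {i \<in> J. x i = y i} < card T"
        using k fin by (metis card_Diff1_less card_mono finite_Diff order_le_less_trans)
      then show False using agree[OF x] by simp
    qed
    then show "x \<in> (\<Union>i\<in>J - T. ?S i)" using x assms(5) by (fastforce simp: star_def)
  qed
  then have "card X \<le> card (\<Union>i\<in>J - T. ?S i)"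
    using fin assms(1) by (intro card_mono) (auto simp: finite_star)
  also have "\<dots> \<le> (\<Sum>i\<in>J - T. card (?S i))" using fin by (intro card_UN_le) simp
  also have "\<dots> \<le> of_nat (card (J - T)) * ?m"
  proof (rule sum_bounded_above)
    fix i assume i: "i \<in> J - T"
    then have c: "card (insert i T) = card T + 1" using fin by simp
    \<comment> \<open>Even with \<open>i\<close> added, \<open>T\<close> misses an index, so the
      bound for stars applies with one free coordinate fewer.\<close>
    then have "insert i T \<noteq> I" using assms(4) by auto
    then have "insert i T \<subset> I" using i assms(2,3) by blast
    from card_star_le[OF assms(1) this] show "card (?S i) \<le> ?m" unfolding c
      by (simp add: numeral_2_eq_2)
  qed
  also have "\<dots> \<le> card I * ?m"
    using assms(1,2) card_mono[of I "J - T"] by (intro mult_le_mono1) auto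
  finally show False using large by simp
qed

section \<open>From many families to pairs\<close>

lemma cross_intersecting_pair:
  assumes "cross_intersecting r t l \<A>" "\<forall>j\<in>{1..r}. \<A> j \<noteq> {}"
    and "p \<in> {1..r}" "q \<in> {1..r}" "p \<noteq> q" "x \<in> \<A> p" "y \<in> \<A> q"
  shows "t \<le> card {i \<in> {1..min_parts r l}. x i = y i}"
proof -
  \<comment> \<open>The other families contribute arbitrary members, which exist by nonemptiness;
    agreement of all \<open>r\<close> compositions includes agreement of these two.\<close>
  define u where "u j = (if j = p then x else if j = q then y else SOME z. z \<in> \<A> j)" for j
  have "\<forall>j\<in>{1..r}. u j \<in> \<A> j" using assms(2,6,7) by (simp add: u_def some_in_eq)
  then have "t \<le> card (agreement r l u)" using assms(1) by (simp add: cross_intersecting_def)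
  also have "\<dots> \<le> card {i \<in> {1..min_parts r l}. x i = y i}"
  proof (rule card_mono)
    show "agreement r l u \<subseteq> {i \<in> {1..min_parts r l}. x i = y i}"
    proof
      fix i assume "i \<in> agreement r l u"
      then have "i \<in> {1..min_parts r l}" "u p i = u q i"
        using assms(3,4) unfolding agreement_def by blast+
      then show "i \<in> {i \<in> {1..min_parts r l}. x i = y i}" using assms(5) by (simp add: u_def)
    qed
  qed simp
  finally show ?thesis .
qed

section \<open>Comparing products\<close>

lemma prod_mono_strict_ex:
  fixes f g :: "'a \<Rightarrow> nat"
  assumes "finite S" "\<And>j. j \<in> S \<Longrightarrow> f j \<le> g j" "\<And>j. j \<in> S \<Longrightarrow> 0 < g j" "p \<in> S" "f p < g p"
  shows "prod f S < prod g S"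
proof -
  have "prod f (S - {p}) \<le> prod g (S - {p})" using assms by (intro prod_mono) auto
  moreover have "0 < prod g (S - {p})" using assms by (intro prod_pos) auto
  ultimately have "f p * prod f (S - {p}) < g p * prod g (S - {p})"
    using assms(5) by (meson le_less_trans less_le_trans mult_le_mono2 mult_less_mono1 nat_mult_less_cancel_disj)
  then show ?thesis using assms(1,4) by (simp add: prod.remove)
qed

text \<open>Every index costs at most a factor \<open>B\<close>, and \<open>p\<close> a further
  \<open>K\<close>; the shortfall \<open>N\<close> at \<open>p\<close> outweighs all of them
  together.\<close>

lemma prod_less_of_small_factor:
  fixes a M :: "'a \<Rightarrow> nat"
  assumes "finite S" "p \<in> S" "\<And>j. j \<in> S \<Longrightarrow> 0 < M j" "\<And>j. j \<in> S \<Longrightarrow> a j \<le> B * M j"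
    and "N * a p \<le> B * K * M p" "B ^ card S * K < N"
  shows "prod a S < prod M S"
proof -
  let ?R = "S - {p}"
  have "N * prod a S = (N * a p) * prod a ?R" using assms(1,2) by (simp add: prod.remove)
  also have "\<dots> \<le> (B * K * M p) * (\<Prod>j\<in>?R. B * M j)"
    using assms(4) by (intro mult_le_mono[OF assms(5)] prod_mono) auto
  also have "\<dots> = B ^ card S * K * prod M S"
    unfolding prod.remove[OF assms(1,2), of M] card.remove[OF assms(1,2)]
    by (simp add: prod.distrib ac_simps)
  also have "\<dots> < N * prod M S"
    using assms(3,6) by (intro mult_less_mono1 prod_pos) auto
  finally show ?thesis by simp
qed

section \<open>Bound on the product and its equality case\<close>

theorem theorem1p3:
  fixes r t :: nat and l :: "nat \<Rightarrow> nat"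
  assumes "r \<ge> 2" and "t \<ge> 1" and "\<forall>j\<in>{1..r}. l j \<ge> 1"
    and "min_parts r l \<ge> t + 2"
  shows "\<exists>n0\<ge>1. \<forall>(n :: nat \<Rightarrow> nat) (\<A> :: nat \<Rightarrow> (nat \<Rightarrow> nat) set).
    (\<forall>j\<in>{1..r}. n j \<ge> n0) \<longrightarrow>
    (\<forall>j\<in>{1..r}. \<A> j \<subseteq> weak_compositions (n j) (l j)) \<longrightarrow>
    cross_intersecting r t l \<A> \<longrightarrow>
      (\<Prod>j = 1..r. card (\<A> j)) \<le> (\<Prod>j = 1..r. (n j + l j - t - 1) choose (l j - t - 1)) \<and>
      ((\<Prod>j = 1..r. card (\<A> j)) = (\<Prod>j = 1..r. (n j + l j - t - 1) choose (l j - t - 1)) \<longleftrightarrow>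
       (\<exists>T. T \<subseteq> {1..min_parts r l} \<and> card T = t \<and>
          (\<forall>j\<in>{1..r}. \<A> j = {u \<in> weak_compositions (n j) (l j). \<forall>i\<in>T. u i = 0})))"
proof -
  define L where "L = min_parts r l"
  \<comment> \<open>The number of stars in the pigeonhole argument, one for each
    \<open>t\<close>-subset of the common coordinates.\<close>
  define B where "B = L choose t"
  \<comment> \<open>The sum dominates \<open>B ^ r * (l p * l p)\<close> for whichever
    \<open>p\<close> turns out to be small; the added 1 makes this strict.\<close>
  define n0 where "n0 = 1 + (\<Sum>j = 1..r. B ^ r * (l j * l j))"
  have L_le: "L \<le> l j" if "j \<in> {1..r}" for j
    unfolding L_def min_parts_def using that by (intro Min_le) auto
  have L: "t + 2 \<le> L" using assms(4) by (simp add: L_def)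
  have l: "t + 2 \<le> l j" if "j \<in> {1..r}" for j using L L_le[OF that] by simp
  show ?thesis
  proof (intro exI[of _ n0] conjI allI impI)
    show "1 \<le> n0" by (simp add: n0_def)
    fix n :: "nat \<Rightarrow> nat" and \<A> :: "nat \<Rightarrow> (nat \<Rightarrow> nat) set"
    assume n: "\<forall>j\<in>{1..r}. n0 \<le> n j"
      and sub: "\<forall>j\<in>{1..r}. \<A> j \<subseteq> weak_compositions (n j) (l j)"
      and cross: "cross_intersecting r t l \<A>"
    \<comment> \<open>\<open>M j\<close> is the largest size of a star with \<open>t\<close>
      prescribed coordinates, \<open>m j\<close> the corresponding bound for
      \<open>t + 1\<close>.\<close>
    define M where "M j = (n j + l j - t - 1) choose (l j - t - 1)" for j
    define m where "m j = (n j + l j - t - 2) choose (l j - t - 2)" for j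
    define S where "S j T c = star {1..l j} (n j) T c" for j T c
    let ?zero_star = "\<lambda>T. T \<subseteq> {1..L} \<and> card T = t \<and> (\<forall>j\<in>{1..r}. \<A> j = S j T (\<lambda>_. 0))"
    have M_pos: "0 < M j" for j by (simp add: M_def)
    have T_sub: "T \<subset> {1..l j}" if "T \<subseteq> {1..L}" "card T = t" "j \<in> {1..r}" for T j
    proof
      show "T \<subseteq> {1..l j}" using that(1) L_le[OF that(3)] by fastforce
      show "T \<noteq> {1..l j}" using that(2) l[OF that(3)] by auto
    qed
    have S_le: "card (S j T c) \<le> M j" if "T \<subseteq> {1..L}" "card T = t" "j \<in> {1..r}" for T c j
      using card_star_le[OF _ T_sub[OF that], of "n j" c] that by (simp add: S_def M_def)
    have zero: "(\<Prod>j = 1..r. card (\<A> j)) = (\<Prod>j = 1..r. M j)" if "?zero_star T" for T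
    proof (rule prod.cong)
      fix j assume j: "j \<in> {1..r}"
      show "card (\<A> j) = M j"
        using card_star_zero[OF _ T_sub[OF _ _ j], of T "\<lambda>_. 0" "n j"] that j by (simp add: S_def M_def)
    qed simp
    \<comment> \<open>Either some family is empty, or all lie in stars with the same
      \<open>T\<close> and values, or one is of lower order than a star.\<close>
    consider (empty) "\<exists>j\<in>{1..r}. \<A> j = {}"
      | (common) T c where "\<forall>j\<in>{1..r}. \<A> j \<noteq> {}" "T \<subseteq> {1..L}" "card T = t" "\<forall>j\<in>{1..r}. \<A> j \<subseteq> S j T c"
      | (small) p where "\<forall>j\<in>{1..r}. \<A> j \<noteq> {}" "p \<in> {1..r}" "card (\<A> p) \<le> B * (l p * m p)"
    proof (cases "\<exists>j\<in>{1..r}. \<A> j = {}")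
      case False
      then have ne: "\<forall>j\<in>{1..r}. \<A> j \<noteq> {}" by blast
      note pair = cross_intersecting_pair[OF cross ne, folded L_def]
      have forces: "\<A> q \<subseteq> S q T c"
        if "p \<in> {1..r}" "q \<in> {1..r}" "p \<noteq> q" "T \<subseteq> {1..L}" "card T = t"
          "l p * m p < card (\<A> p \<inter> S p T c)" for p q T c
      proof
        fix y assume y: "y \<in> \<A> q"
        have "\<forall>i\<in>T. y i = c i"
        proof (rule large_star_forces)
          show "{1..L} \<subseteq> {1..l p}" using L_le[OF that(1)] by simp
          show "card T + 2 \<le> card {1..l p}" using l[OF that(1)] that(5) by simp
          show "\<A> p \<inter> S p T c \<subseteq> star {1..l p} (n p) T c" by (simp add: S_def)
          show "card T \<le> card {i \<in> {1..L}. x i = y i}" if "x \<in> \<A> p \<inter> S p T c" for x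
            using pair[OF \<open>p \<in> {1..r}\<close> \<open>q \<in> {1..r}\<close> \<open>p \<noteq> q\<close> _ y, of x] that \<open>card T = t\<close> by simp
          show "card {1..l p} * ((n p + card {1..l p} - card T - 2) choose
              (card {1..l p} - card T - 2)) < card (\<A> p \<inter> S p T c)"
            using that(5,6) by (simp add: m_def)
        qed (use that(4) in simp_all)
        moreover have "y \<in> compositions_on {1..l q} (n q)"
          using sub that(2) y unfolding weak_compositions_eq by blast
        ultimately show "y \<in> S q T c" by (simp add: S_def star_def)
      qed
      have 12: "1 \<in> {1..r}" "2 \<in> {1..r}" using assms(1) by auto
      show ?thesis
      \<comment> \<open>Above this threshold, one of the \<open>B\<close> stars holds more than
        \<open>l * m\<close> members, which is what \<open>forces\<close> requires.\<close>
      proof (cases "card (\<A> 1) \<le> B * (l 1 * m 1) \<or> card (\<A> 2) \<le> B * (l 2 * m 2)")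
        case True
        then show ?thesis using ne 12 small by blast
      next
        case large: False
        obtain y where y: "y \<in> \<A> 2" using ne 12 by blast
        obtain T where T: "T \<subseteq> {1..L}" "card T = t" "l 1 * m 1 < card (\<A> 1 \<inter> S 1 T y)"
        proof (rule exists_large_star)
          show "\<A> 1 \<subseteq> compositions_on {1..l 1} (n 1)"
            using sub 12(1) unfolding weak_compositions_eq by blast
          show "t \<le> card {i \<in> {1..L}. x i = y i}" if "x \<in> \<A> 1" for x
            using pair[OF 12 _ that y] by simp
          show "(card {1..L} choose t) * (l 1 * m 1) < card (\<A> 1)"
            using large by (simp add: B_def)
        qed (use that in \<open>simp_all add: S_def\<close>)
        have others: "\<A> q \<subseteq> S q T y" if "q \<in> {1..r}" "q \<noteq> 1" for q
          using forces[OF 12(1) that(1) _ T] that(2) by simp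
        \<comment> \<open>\<open>others\<close> leaves out family 1. Family 2 now lies wholly in its
          star and is itself large, so it forces family 1 back into the star with the same
          \<open>T\<close> and \<open>y\<close>.\<close>
        then have "\<A> 2 \<inter> S 2 T y = \<A> 2" using others[OF 12(2)] by (simp add: Int_absorb2)
        moreover have "1 \<le> B" using L by (simp add: B_def Suc_leI)
        then have "1 * (l 2 * m 2) \<le> B * (l 2 * m 2)" by (rule mult_le_mono1)
        then have "l 2 * m 2 < card (\<A> 2)" using large by linarith
        ultimately have "l 2 * m 2 < card (\<A> 2 \<inter> S 2 T y)" by simp
        then have "\<A> 1 \<subseteq> S 1 T y" using forces[OF 12(2,1) _ T(1,2)] by simp
        then show ?thesis using common[OF ne T(1,2)] others by blast
      qed
    qed (rule empty)
    \<comment> \<open>Since zero stars attain the bound, this dichotomy yields both the inequality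
      and the equality case.\<close>
    then have "(\<Prod>j = 1..r. card (\<A> j)) < (\<Prod>j = 1..r. M j) \<or> (\<exists>T. ?zero_star T)"
    proof cases
      case empty
      then have "(\<Prod>j = 1..r. card (\<A> j)) = 0"
        by (metis card.empty finite_atLeastAtMost prod_zero)
      moreover have "0 < (\<Prod>j = 1..r. M j)" using M_pos by (intro prod_pos) auto
      ultimately show ?thesis by (intro disjI1) linarith
    next
      case (common T c)
      have le: "card (\<A> j) \<le> card (S j T c)" if "j \<in> {1..r}" for j
        using common(4) that by (intro card_mono) (auto simp: S_def finite_star)
      show ?thesis
      proof (cases "\<exists>p\<in>{1..r}. card (\<A> p) < M p")
        case True
        then obtain p where "p \<in> {1..r}" "card (\<A> p) < M p" by blast
        then have "(\<Prod>j = 1..r. card (\<A> j)) < (\<Prod>j = 1..r. M j)"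
          using M_pos le_trans[OF le S_le[OF common(2,3)]]
          by (intro prod_mono_strict_ex[where p = p]) auto
        then show ?thesis by blast
      next
        case False
        \<comment> \<open>All families now have full star size \<open>M j\<close>, which a nonzero
          prescribed value would rule out already for family 1.\<close>
        have c0: "c i = 0" if "i \<in> T" for i
        proof (rule ccontr)
          assume "c i \<noteq> 0"
          have 1: "1 \<in> {1..r}" using assms(1) by simp
          have "card (S 1 T c) < M 1"
            using card_star_less[of "{1..l 1}" T i c "n 1"] T_sub[OF common(2,3) 1] l[OF 1]
              common(3) that \<open>c i \<noteq> 0\<close> by (auto simp: S_def M_def)
          then show False using False le[OF 1] 1 by force
        qed
        have "\<A> j = S j T (\<lambda>_. 0)" if j: "j \<in> {1..r}" for j
        proof -
          have "\<A> j = S j T c"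
          proof (rule card_seteq)
            have "M j \<le> card (\<A> j)" using False j by (simp add: not_less)
            then show "card (S j T c) \<le> card (\<A> j)"
              using S_le[OF common(2,3) j] le_trans by blast
          qed (use common(4) j in \<open>simp_all add: S_def finite_star\<close>)
          also have "\<dots> = S j T (\<lambda>_. 0)" using c0 by (simp add: S_def star_def)
          finally show ?thesis .
        qed
        then show ?thesis using common(2,3) by blast
      qed
    next
      case (small p)
      note pair = cross_intersecting_pair[OF cross small(1), folded L_def]
      \<comment> \<open>Otherwise, by pigeonhole against a member of any other family, some star
        would exceed its maximal size \<open>M j\<close>.\<close>
      have le: "card (\<A> j) \<le> B * M j" if j: "j \<in> {1..r}" for j
      proof (rule ccontr)
        assume "\<not> card (\<A> j) \<le> B * M j"
        then have large: "(card {1..L} choose t) * M j < card (\<A> j)" by (simp add: B_def)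
        define q where "q = (if j = 1 then 2 else 1 :: nat)"
        have q: "q \<in> {1..r}" "j \<noteq> q" using assms(1) by (auto simp: q_def)
        obtain y where y: "y \<in> \<A> q" using small(1) q by blast
        obtain T where T: "T \<subseteq> {1..L}" "card T = t" "M j < card (\<A> j \<inter> S j T y)"
        proof (rule exists_large_star[OF _ _ pair[OF j q _ y] large])
          show "\<A> j \<subseteq> compositions_on {1..l j} (n j)"
            using sub j unfolding weak_compositions_eq by blast
        qed (use that in \<open>simp_all add: S_def\<close>)
        have "card (\<A> j \<inter> S j T y) \<le> card (S j T y)"
          by (intro card_mono) (auto simp: S_def finite_star)
        then show False using T S_le[OF T(1,2) j, of y] by simp
      qed
      let ?k = "l p - t - 1"
      have "m p = (n p + l p - t - 1 - 1) choose (?k - 1)"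
        by (simp add: m_def numeral_2_eq_2)
      moreover have "n p \<le> n p + l p - t - 1" using l[OF small(2)] by simp
      \<comment> \<open>The absorption identity
        \<open>k * (a choose k) = a * ((a - 1) choose (k - 1))\<close> shows that \<open>m p\<close>
        is at most \<open>M p\<close> times \<open>l p / n p\<close>.\<close>
      ultimately have "n p * m p \<le> (n p + l p - t - 1) * ((n p + l p - t - 1 - 1) choose (?k - 1))"
        using mult_le_mono1 by presburger
      also have "\<dots> = ?k * M p"
        using l[OF small(2)] unfolding M_def by (subst times_binomial_minus1_eq) auto
      finally have "n p * m p \<le> l p * M p" by (rule le_trans) simp
      then have "(B * l p) * (n p * m p) \<le> (B * l p) * (l p * M p)" by (rule mult_le_mono2)
      with mult_le_mono2[OF small(3), of "n p"]
      have np: "n p * card (\<A> p) \<le> B * (l p * l p) * M p" by (simp only: ac_simps)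
      have "B ^ r * (l p * l p) \<le> (\<Sum>j = 1..r. B ^ r * (l j * l j))"
        using small(2) by (intro member_le_sum) auto
      also have "\<dots> < n p" using n small(2) by (force simp: n0_def)
      finally have "B ^ card {1..r} * (l p * l p) < n p" by simp
      from prod_less_of_small_factor[where a = "\<lambda>j. card (\<A> j)" and M = M,
          OF _ small(2) M_pos le np this]
      show ?thesis by blast
    qed
    then have le: "(\<Prod>j = 1..r. card (\<A> j)) \<le> (\<Prod>j = 1..r. M j)"
      and eq: "(\<Prod>j = 1..r. card (\<A> j)) = (\<Prod>j = 1..r. M j) \<longleftrightarrow> (\<exists>T. ?zero_star T)"
      using zero less_imp_le order.eq_iff less_irrefl by metis+
    show "(\<Prod>j = 1..r. card (\<A> j)) \<le> (\<Prod>j = 1..r. (n j + l j - t - 1) choose (l j - t - 1))"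
      using le by (simp add: M_def)
    show "((\<Prod>j = 1..r. card (\<A> j)) = (\<Prod>j = 1..r. (n j + l j - t - 1) choose (l j - t - 1)) \<longleftrightarrow>
       (\<exists>T. T \<subseteq> {1..min_parts r l} \<and> card T = t \<and>
          (\<forall>j\<in>{1..r}. \<A> j = {u \<in> weak_compositions (n j) (l j). \<forall>i\<in>T. u i = 0})))"
      using eq by (simp add: M_def S_def L_def star_def weak_compositions_eq)
  qed
qed

end
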